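(* Let $\mathbf{L}=\langle L,\leq,\otimes,\rightarrow,0,1\rangle$ be a complete residuated lattice, ${}^*$ an idempotent truth-stressing hedge on $\mathbf{L}$, and $S=\{\langle f_{a^*},h_{a^*}\rangle;\ a\in L\}$, where $f_c(x)=c\otimes x$ and $h_c(x)=c\rightarrow x$ for $x\in L$. Define $\rightsquigarrow$ on $S$ by $$\langle f_{a^*},h_{a^*}\rangle\rightsquigarrow\langle f_{b^*},h_{b^*}\rangle=\bigvee\{\langle f_{c^*},h_{c^*}\rangle;\ a^*\otimes c^*\leq b^*,\ c\in L\}$$ (supremum with respect to $\leqslant$). Then $\langle S,\leqslant,\circ,\rightsquigarrow,\langle f_\bot,h_\bot\rangle,\langle\mathrm{id},\mathrm{id}\rangle\rangle$ is a complete commutative integral residuated lattice.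
   Context: A complete (commutative integral) residuated lattice: a complete lattice with least element (here $0$ / $\langle f_\bot,h_\bot\rangle$) and greatest element (here $1$ / $\langle\mathrm{id},\mathrm{id}\rangle$), with an associative commutative multiplication whose neutral element is the greatest element, and a residuum satisfying $x\otimes y\leq z$ iff $y\leq x\rightarrow z$. An idempotent truth-stressing hedge is ${}^*\colon L\to L$ with $1^*=1$, $a^*\leq a$, $(a\rightarrow b)^*\leq a^*\rightarrow b^*$, $a^{**}=a^*$. Isotone Galois connections in $\langle L,\leq\rangle$ are pairs $\langle f,h\rangle$ with $f(a)\leq b$ iff $a\leq h(b)$; composition $\langle f_1,h_1\rangle\circ\langle f_2,h_2\rangle=\langle f_1f_2,h_2h_1\rangle$; $\langle f_1,h_1\rangle\leqslant\langle f_2,h_2\rangle$ iff $f_1(a)\leq f_2(a)$ for all $a\in L$. $f_\bot(a)=0$ and $h_\bot(a)=1$ for all $a\in L$. *)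

theory Defs
  imports "HOL-Algebra.Galois_Connection"
begin

record 'a reslat = "'a gorder" +
  tensor :: "['a, 'a] \<Rightarrow> 'a" (infixl \<open>\<otimes>\<index>\<close> 70)
  resid :: "['a, 'a] \<Rightarrow> 'a" (infixr \<open>\<rightarrow>\<index>\<close> 65)
  zero :: 'a (\<open>\<zero>\<index>\<close>)
  one :: 'a (\<open>\<one>\<index>\<close>)

text \<open>Residuated lattices are always commutative and integral here: the neutral element of
  the multiplication is the greatest element.\<close>

locale complete_residuated_lattice = complete_lattice L for L (structure) +
  assumes zero_least: "least L \<zero> (carrier L)"
    and one_greatest: "greatest L \<one> (carrier L)"
    and tensor_closed: "\<lbrakk>x \<in> carrier L; y \<in> carrier L\<rbrakk> \<Longrightarrow> x \<otimes> y \<in> carrier L"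
    and tensor_assoc: "\<lbrakk>x \<in> carrier L; y \<in> carrier L; z \<in> carrier L\<rbrakk> \<Longrightarrow>
      (x \<otimes> y) \<otimes> z = x \<otimes> (y \<otimes> z)"
    and tensor_comm: "\<lbrakk>x \<in> carrier L; y \<in> carrier L\<rbrakk> \<Longrightarrow> x \<otimes> y = y \<otimes> x"
    and one_tensor: "x \<in> carrier L \<Longrightarrow> \<one> \<otimes> x = x"
    and resid_closed: "\<lbrakk>x \<in> carrier L; y \<in> carrier L\<rbrakk> \<Longrightarrow> x \<rightarrow> y \<in> carrier L"
    and adjointness: "\<lbrakk>x \<in> carrier L; y \<in> carrier L; z \<in> carrier L\<rbrakk> \<Longrightarrow>
      x \<otimes> y \<sqsubseteq> z \<longleftrightarrow> y \<sqsubseteq> x \<rightarrow> z"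

locale idempotent_hedge = complete_residuated_lattice L for L (structure) +
  fixes star :: "'a \<Rightarrow> 'a"
  assumes star_closed: "a \<in> carrier L \<Longrightarrow> star a \<in> carrier L"
    and star_one: "star \<one> = \<one>"
    and star_le: "a \<in> carrier L \<Longrightarrow> star a \<sqsubseteq> a"
    and star_resid: "\<lbrakk>a \<in> carrier L; b \<in> carrier L\<rbrakk> \<Longrightarrow>
      star (a \<rightarrow> b) \<sqsubseteq> star a \<rightarrow> star b"
    and star_idem: "a \<in> carrier L \<Longrightarrow> star (star a) = star a"

text \<open>Maps \<open>L \<rightarrow> L\<close> are represented by extensional functions on the carrier, so that equality
  of pairs is equality of maps on \<open>L\<close>.\<close>

definition isotone_galois ::
    "('a, 'm) gorder_scheme \<Rightarrow> (('a \<Rightarrow> 'a) \<times> ('a \<Rightarrow> 'a)) set" where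
  "isotone_galois L = {(f, h). f \<in> extensional (carrier L) \<and> h \<in> extensional (carrier L) \<and>
     galois_connection \<lparr>orderA = L, orderB = L, lower = f, upper = h\<rparr>}"

definition gc_le ::
    "('a, 'm) gorder_scheme \<Rightarrow> ('a \<Rightarrow> 'a) \<times> ('a \<Rightarrow> 'a) \<Rightarrow> ('a \<Rightarrow> 'a) \<times> ('a \<Rightarrow> 'a) \<Rightarrow> bool" where
  "gc_le L p q \<longleftrightarrow> (\<forall>a \<in> carrier L. fst p a \<sqsubseteq>\<^bsub>L\<^esub> fst q a)"

definition gc_order ::
    "('a, 'm) gorder_scheme \<Rightarrow> (('a \<Rightarrow> 'a) \<times> ('a \<Rightarrow> 'a)) gorder" where
  "gc_order L = \<lparr>carrier = isotone_galois L, eq = (=), le = gc_le L\<rparr>"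

definition gc_comp ::
    "('a, 'm) gorder_scheme \<Rightarrow> ('a \<Rightarrow> 'a) \<times> ('a \<Rightarrow> 'a) \<Rightarrow> ('a \<Rightarrow> 'a) \<times> ('a \<Rightarrow> 'a) \<Rightarrow>
      ('a \<Rightarrow> 'a) \<times> ('a \<Rightarrow> 'a)" where
  "gc_comp L p q =
     (compose (carrier L) (fst p) (fst q), compose (carrier L) (snd q) (snd p))"

definition gc_id :: "('a, 'm) gorder_scheme \<Rightarrow> ('a \<Rightarrow> 'a) \<times> ('a \<Rightarrow> 'a)" where
  "gc_id L = (\<lambda>x \<in> carrier L. x, \<lambda>x \<in> carrier L. x)"

definition gc_bot :: "('a, 'm) reslat_scheme \<Rightarrow> ('a \<Rightarrow> 'a) \<times> ('a \<Rightarrow> 'a)" where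
  "gc_bot L = (\<lambda>x \<in> carrier L. \<zero>\<^bsub>L\<^esub>, \<lambda>x \<in> carrier L. \<one>\<^bsub>L\<^esub>)"

definition gc_mult :: "('a, 'm) reslat_scheme \<Rightarrow> 'a \<Rightarrow> ('a \<Rightarrow> 'a) \<times> ('a \<Rightarrow> 'a)" where
  "gc_mult L c = (\<lambda>x \<in> carrier L. c \<otimes>\<^bsub>L\<^esub> x, \<lambda>x \<in> carrier L. c \<rightarrow>\<^bsub>L\<^esub> x)"

definition hedge_gcs ::
    "('a, 'm) reslat_scheme \<Rightarrow> ('a \<Rightarrow> 'a) \<Rightarrow> (('a \<Rightarrow> 'a) \<times> ('a \<Rightarrow> 'a)) set" where
  "hedge_gcs L star = {gc_mult L (star a) | a. a \<in> carrier L}"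

text \<open>The residuum on \<open>S\<close> is given through representatives of its arguments; independence of
  the representatives is \<open>gc_resid_gc_mult\<close> below. The supremum is taken among all isotone
  Galois connections in \<open>L\<close>.\<close>

definition gc_resid ::
    "('a, 'm) reslat_scheme \<Rightarrow> ('a \<Rightarrow> 'a) \<Rightarrow> ('a \<Rightarrow> 'a) \<times> ('a \<Rightarrow> 'a) \<Rightarrow>
      ('a \<Rightarrow> 'a) \<times> ('a \<Rightarrow> 'a) \<Rightarrow> ('a \<Rightarrow> 'a) \<times> ('a \<Rightarrow> 'a)" where
  "gc_resid L star p q = (THE r. \<exists>a \<in> carrier L. \<exists>b \<in> carrier L.
     p = gc_mult L (star a) \<and> q = gc_mult L (star b) \<and>
     r = \<Squnion>\<^bsub>gc_order L\<^esub> {gc_mult L (star c) | c.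
           c \<in> carrier L \<and> star a \<otimes>\<^bsub>L\<^esub> star c \<sqsubseteq>\<^bsub>L\<^esub> star b})"

context complete_residuated_lattice
begin

lemma one_closed: "\<one> \<in> carrier L"
  using one_greatest by (simp add: greatest_def)

lemma gc_mult_inj:
  assumes "c \<in> carrier L" "d \<in> carrier L" "gc_mult L c = gc_mult L d"
  shows "c = d"
proof -
  have "fst (gc_mult L c) \<one> = fst (gc_mult L d) \<one>"
    using assms(3) by simp
  then have "c \<otimes> \<one> = d \<otimes> \<one>"
    using one_closed by (simp add: gc_mult_def)
  then show ?thesis
    using assms(1,2) by (simp add: tensor_comm[OF _ one_closed] one_tensor)
qed

lemma gc_mult_isotone_galois:
  assumes "c \<in> carrier L"
  shows "gc_mult L c \<in> isotone_galois L"
proof -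
  have "galois_connection \<lparr>orderA = L, orderB = L,
      lower = (\<lambda>x \<in> carrier L. c \<otimes> x), upper = (\<lambda>x \<in> carrier L. c \<rightarrow> x)\<rparr>"
    unfolding galois_connection_def connection_def galois_connection_axioms_def
    using assms by (simp add: partial_order_axioms tensor_closed resid_closed adjointness)
  then show ?thesis
    by (simp add: isotone_galois_def gc_mult_def)
qed

end

lemma (in idempotent_hedge) gc_resid_gc_mult:
  assumes "a \<in> carrier L" "b \<in> carrier L"
  shows "gc_resid L star (gc_mult L (star a)) (gc_mult L (star b)) =
    \<Squnion>\<^bsub>gc_order L\<^esub> {gc_mult L (star c) | c. c \<in> carrier L \<and> star a \<otimes> star c \<sqsubseteq> star b}"
proof -
  have inj: "star x = star y"
    if "x \<in> carrier L" "y \<in> carrier L" "gc_mult L (star x) = gc_mult L (star y)" for x y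
    by (rule gc_mult_inj) (use that star_closed in simp_all)
  show ?thesis
    unfolding gc_resid_def
  proof (rule the_equality, goal_cases)
    case 1
    show ?case by (rule bexI[of _ a], rule bexI[of _ b]) (simp_all add: assms)
  next
    case (2 r)
    then obtain a' b' where ab: "a' \<in> carrier L" "b' \<in> carrier L"
      "gc_mult L (star a) = gc_mult L (star a')" "gc_mult L (star b) = gc_mult L (star b')"
      "r = \<Squnion>\<^bsub>gc_order L\<^esub> {gc_mult L (star c) | c. c \<in> carrier L \<and> star a' \<otimes> star c \<sqsubseteq> star b'}"
      by (elim bexE conjE) (rule that)
    have "star a' = star a" "star b' = star b"
      using inj[OF assms(1) ab(1,3)] inj[OF assms(2) ab(2,4)] by simp_all
    then show ?case using ab(5) by simp
  qed
qed

end

theory Submission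
  imports Defs
begin

text \<open>The map \<open>c \<mapsto> \<langle>f\<^sub>c, h\<^sub>c\<rangle>\<close> is an order embedding that turns multiplication into
  composition, so \<open>S\<close> is a copy of the set of fixpoints of the hedge. The hedge is an interior
  operator whose fixpoints contain \<open>0\<close> and \<open>1\<close> and are closed under multiplication and under
  suprema taken in \<open>L\<close>, and infima of fixpoints are obtained by applying the hedge to infima in
  \<open>L\<close>. The supremum defining the residuum is attained, namely at \<open>(a\<^sup>* \<rightarrow> b\<^sup>*)\<^sup>*\<close>.\<close>

section \<open>Bounds of images, and the order on isotone Galois connections\<close>

lemma mem_Upper_image_iff:
  fixes L (structure)
  assumes "g ` B \<subseteq> carrier L"
  shows "p \<in> Upper L (g ` B) \<longleftrightarrow> p \<in> carrier L \<and> (\<forall>b \<in> B. g b \<sqsubseteq> p)"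
  using assms by (auto simp: Upper_def)

lemma mem_Lower_image_iff:
  fixes L (structure)
  assumes "g ` B \<subseteq> carrier L"
  shows "p \<in> Lower L (g ` B) \<longleftrightarrow> p \<in> carrier L \<and> (\<forall>b \<in> B. p \<sqsubseteq> g b)"
  using assms by (auto simp: Lower_def)

text \<open>\<open>gc_le\<close> compares lower maps only, but a lower map determines its upper
  adjoint; extensionality then turns agreement on the carrier into equality of pairs.\<close>

lemma isotone_galois_le_antisym:
  assumes "partial_order L" "p \<in> isotone_galois L" "q \<in> isotone_galois L"
    and "gc_le L p q" "gc_le L q p"
  shows "p = q"
proof -
  interpret partial_order L by fact
  obtain f h f' h' where pq: "p = (f, h)" "q = (f', h')" by (cases p, cases q)
  have ext: "f \<in> extensional (carrier L)" "h \<in> extensional (carrier L)"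
      "f' \<in> extensional (carrier L)" "h' \<in> extensional (carrier L)"
    and gc: "galois_connection \<lparr>orderA = L, orderB = L, lower = f, upper = h\<rparr>"
      "galois_connection \<lparr>orderA = L, orderB = L, lower = f', upper = h'\<rparr>"
    using assms(2,3) by (auto simp: isotone_galois_def pq)
  have cl: "f x \<in> carrier L" "h x \<in> carrier L" "f' x \<in> carrier L" "h' x \<in> carrier L"
    if "x \<in> carrier L" for x
    using gc that unfolding galois_connection_def connection_def by auto
  have adj: "f x \<sqsubseteq>\<^bsub>L\<^esub> y \<longleftrightarrow> x \<sqsubseteq>\<^bsub>L\<^esub> h y" "f' x \<sqsubseteq>\<^bsub>L\<^esub> y \<longleftrightarrow> x \<sqsubseteq>\<^bsub>L\<^esub> h' y"
    if "x \<in> carrier L" "y \<in> carrier L" for x y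
    using gc that unfolding galois_connection_def galois_connection_axioms_def by auto
  have f: "f x = f' x" if "x \<in> carrier L" for x
    using assms(4,5) that cl by (auto simp: gc_le_def pq intro: le_antisym)
  \<comment> \<open>Each of \<open>h y\<close> and \<open>h' y\<close> lies below the other: both
    adjunctions are evaluated at these two points, where \<open>f\<close> and \<open>f'\<close>
    agree.\<close>
  have "h y = h' y" if y: "y \<in> carrier L" for y
    using adj[OF cl(2)[OF y] y] adj[OF cl(4)[OF y] y] f[OF cl(2)[OF y]] f[OF cl(4)[OF y]] cl[OF y]
    by (auto intro: le_antisym)
  then show ?thesis
    using ext f by (auto simp: pq intro: extensionalityI)
qed

text \<open>The supremum is a choice among least upper bounds. A greatest element is one of them,
  and antisymmetry leaves no other, so the choice is determined without first showing that suprema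
  exist in \<open>gc_order L\<close>.\<close>

lemma gc_order_sup_eq_max:
  assumes "partial_order L" "A \<subseteq> isotone_galois L" "m \<in> A" "\<And>p. p \<in> A \<Longrightarrow> gc_le L p m"
  shows "\<Squnion>\<^bsub>gc_order L\<^esub> A = m"
  unfolding sup_def
proof (rule some_equality)
  have U: "u \<in> Upper (gc_order L) A \<longleftrightarrow> u \<in> isotone_galois L \<and> (\<forall>p \<in> A. gc_le L p u)" for u
    using assms(2) by (auto simp: Upper_def gc_order_def simp del: split_paired_All)
  have least: "least (gc_order L) u (Upper (gc_order L) A) \<longleftrightarrow>
      u \<in> Upper (gc_order L) A \<and> (\<forall>v \<in> Upper (gc_order L) A. gc_le L u v)" for u
    using Upper_closed[of "gc_order L" A] by (auto simp: least_def gc_order_def)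
  have m: "m \<in> Upper (gc_order L) A"
    using assms(2-4) by (auto simp: U)
  then show "least (gc_order L) m (Upper (gc_order L) A)"
    using assms(3) by (simp add: least U)
  fix r assume "least (gc_order L) r (Upper (gc_order L) A)"
  then have r: "r \<in> Upper (gc_order L) A" "gc_le L r m"
    using m by (simp_all add: least)
  have "r \<in> isotone_galois L" "gc_le L m r" "m \<in> isotone_galois L"
    using r(1) m assms(3) by (simp_all add: U)
  then show "r = m"
    using r(2) isotone_galois_le_antisym[OF assms(1)] by blast
qed

section \<open>Multiplication maps as an order-embedded copy of \<open>L\<close>\<close>

context complete_residuated_lattice
begin

lemma zero_closed: "\<zero> \<in> carrier L"
  using zero_least by (simp add: least_def)

lemma zero_le: "x \<in> carrier L \<Longrightarrow> \<zero> \<sqsubseteq> x"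
  using zero_least by (simp add: least_def)

lemma le_one: "x \<in> carrier L \<Longrightarrow> x \<sqsubseteq> \<one>"
  using one_greatest by (simp add: greatest_def Lower_def)

lemma tensor_one: "x \<in> carrier L \<Longrightarrow> x \<otimes> \<one> = x"
  using tensor_comm[of x \<one>] one_tensor one_closed by simp

lemma tensor_mono_left:
  assumes "x \<in> carrier L" "y \<in> carrier L" "z \<in> carrier L" "x \<sqsubseteq> y"
  shows "x \<otimes> z \<sqsubseteq> y \<otimes> z"
proof -
  have "y \<sqsubseteq> z \<rightarrow> z \<otimes> y"
    using assms adjointness[of z y "z \<otimes> y"] by (simp add: tensor_closed)
  then have "x \<sqsubseteq> z \<rightarrow> z \<otimes> y"
    using assms by (blast intro: le_trans tensor_closed resid_closed)
  then show ?thesis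
    using assms adjointness[of z x "z \<otimes> y"] tensor_comm[of z] by (simp add: tensor_closed)
qed

text \<open>Evaluation at \<open>\<one>\<close> recovers the multiplier; the converse is
  monotonicity of \<otimes>.\<close>

lemma gc_le_gc_mult_iff:
  assumes "c \<in> carrier L" "d \<in> carrier L"
  shows "gc_le L (gc_mult L c) (gc_mult L d) \<longleftrightarrow> c \<sqsubseteq> d"
proof
  assume "gc_le L (gc_mult L c) (gc_mult L d)"
  then have "c \<otimes> \<one> \<sqsubseteq> d \<otimes> \<one>"
    using one_closed by (auto simp: gc_le_def gc_mult_def)
  then show "c \<sqsubseteq> d"
    using assms by (simp add: tensor_one)
next
  assume "c \<sqsubseteq> d"
  then show "gc_le L (gc_mult L c) (gc_mult L d)"
    using assms by (simp add: gc_le_def gc_mult_def tensor_mono_left)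
qed

text \<open>By adjointness and associativity both sides have the same lower bounds. The reversed
  order of \<open>c\<close> and \<open>d\<close> is the one in which \<open>gc_comp\<close> composes
  upper maps.\<close>

lemma resid_resid:
  assumes "c \<in> carrier L" "d \<in> carrier L" "x \<in> carrier L"
  shows "d \<rightarrow> (c \<rightarrow> x) = c \<otimes> d \<rightarrow> x"
proof -
  have "y \<sqsubseteq> d \<rightarrow> (c \<rightarrow> x) \<longleftrightarrow> y \<sqsubseteq> c \<otimes> d \<rightarrow> x" if "y \<in> carrier L" for y
    using assms that
    by (simp add: adjointness[symmetric] tensor_closed resid_closed tensor_assoc)
  from this[of "d \<rightarrow> (c \<rightarrow> x)"] this[of "c \<otimes> d \<rightarrow> x"] show ?thesis
    using assms by (auto intro: le_antisym simp: tensor_closed resid_closed)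
qed

lemma gc_comp_gc_mult:
  assumes "c \<in> carrier L" "d \<in> carrier L"
  shows "gc_comp L (gc_mult L c) (gc_mult L d) = gc_mult L (c \<otimes> d)"
  using assms
  by (auto simp: gc_comp_def gc_mult_def compose_def fun_eq_iff tensor_closed resid_closed
      tensor_assoc resid_resid)

lemma gc_mult_one: "gc_mult L \<one> = gc_id L"
proof -
  have "\<one> \<rightarrow> x = x" if x: "x \<in> carrier L" for x
    using adjointness[OF one_closed x x]
      adjointness[OF one_closed resid_closed[OF one_closed x] x] x
    by (auto intro: le_antisym simp: one_tensor resid_closed one_closed)
  then show ?thesis
    by (auto simp: gc_mult_def gc_id_def fun_eq_iff one_tensor)
qed

text \<open>By adjointness \<open>x \<otimes> \<zero> \<sqsubseteq> \<zero>\<close> amounts to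
  \<open>\<zero> \<sqsubseteq> x \<rightarrow> \<zero>\<close>.\<close>

lemma zero_tensor: "x \<in> carrier L \<Longrightarrow> \<zero> \<otimes> x = \<zero>"
  using adjointness[of x \<zero> \<zero>] zero_le[of "x \<rightarrow> \<zero>"] zero_le[of "x \<otimes> \<zero>"] tensor_comm[of \<zero> x]
  by (auto intro: le_antisym simp: zero_closed tensor_closed resid_closed)

lemma gc_mult_zero: "gc_mult L \<zero> = gc_bot L"
proof -
  have "\<zero> \<rightarrow> x = \<one>" if x: "x \<in> carrier L" for x
    using adjointness[OF zero_closed one_closed x] le_one[of "\<zero> \<rightarrow> x"] x
    by (auto intro: le_antisym simp: zero_tensor zero_le resid_closed one_closed zero_closed)
  then show ?thesis
    by (auto simp: gc_mult_def gc_bot_def fun_eq_iff zero_tensor)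
qed

end

section \<open>Fixpoints of the hedge\<close>

context idempotent_hedge
begin

text \<open>\<open>a \<sqsubseteq> b\<close> means \<open>a \<rightarrow> b = \<one>\<close>; since
  \<open>star\<close> fixes \<open>\<one>\<close>, the axiom \<open>star_resid\<close> carries this
  over to \<open>star a \<rightarrow> star b\<close>.\<close>

lemma star_mono:
  assumes "a \<in> carrier L" "b \<in> carrier L" "a \<sqsubseteq> b"
  shows "star a \<sqsubseteq> star b"
proof -
  have "\<one> \<sqsubseteq> a \<rightarrow> b"
    using assms adjointness[of a \<one> b] by (simp add: one_closed tensor_one)
  then have "a \<rightarrow> b = \<one>"
    using assms by (simp add: le_antisym le_one resid_closed one_closed)
  then have "\<one> \<sqsubseteq> star a \<rightarrow> star b"
    using star_resid[OF assms(1,2)] by (simp add: star_one)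
  then show ?thesis
    using assms adjointness[of "star a" \<one> "star b"]
    by (simp add: one_closed tensor_one star_closed)
qed

text \<open>Makes \<open>star\<close> right adjoint to the inclusion of the fixpoints into
  \<open>L\<close>; residua and infima in \<open>S\<close> both come from this.\<close>

lemma star_greatest_fixpoint:
  assumes "c \<in> carrier L" "star c = c" "x \<in> carrier L"
  shows "c \<sqsubseteq> star x \<longleftrightarrow> c \<sqsubseteq> x"
proof
  show "c \<sqsubseteq> star x \<Longrightarrow> c \<sqsubseteq> x"
    using assms star_le star_closed by (blast intro: le_trans)
  show "c \<sqsubseteq> x \<Longrightarrow> c \<sqsubseteq> star x"
    using star_mono[of c x] assms by simp
qed

lemma star_fixpointI:
  assumes "x \<in> carrier L" "x \<sqsubseteq> star x"
  shows "star x = x"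
  using assms by (simp add: le_antisym star_le star_closed)

lemma star_zero: "star \<zero> = \<zero>"
  by (simp add: star_fixpointI zero_closed zero_le star_closed)

text \<open>Multiplicativity is not an axiom of hedges, so the product is reached through the
  residuum: the fixpoint \<open>y\<close> lies below
  \<open>star (x \<rightarrow> x \<otimes> y)\<close>, and \<open>star_resid\<close> moves
  \<open>star\<close> inside.\<close>

lemma star_tensor:
  assumes "x \<in> carrier L" "y \<in> carrier L" "star x = x" "star y = y"
  shows "star (x \<otimes> y) = x \<otimes> y"
proof (rule star_fixpointI)
  have "y \<sqsubseteq> x \<rightarrow> x \<otimes> y"
    using assms adjointness[of x y "x \<otimes> y"] by (simp add: tensor_closed)
  then have "y \<sqsubseteq> star (x \<rightarrow> x \<otimes> y)"
    using assms by (simp add: star_greatest_fixpoint tensor_closed resid_closed)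
  also have "\<dots> \<sqsubseteq> x \<rightarrow> star (x \<otimes> y)"
    using star_resid[of x "x \<otimes> y"] assms by (simp add: tensor_closed)
  finally show "x \<otimes> y \<sqsubseteq> star (x \<otimes> y)"
    using assms by (simp add: adjointness tensor_closed resid_closed star_closed)
qed (use assms tensor_closed in simp)

text \<open>Every fixpoint below \<open>\<Squnion>A\<close> is also below
  \<open>star (\<Squnion>A)\<close>, which is therefore an upper bound of \<open>A\<close>.\<close>

lemma star_sup:
  assumes "A \<subseteq> carrier L" "\<And>x. x \<in> A \<Longrightarrow> star x = x"
  shows "star (\<Squnion>A) = \<Squnion>A"
proof (rule star_fixpointI)
  show "\<Squnion>A \<in> carrier L"
    using assms by simp
  show "\<Squnion>A \<sqsubseteq> star (\<Squnion>A)"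
    using assms
    by (intro sup_least) (auto simp: star_greatest_fixpoint subsetD star_closed intro: sup_upper)
qed

text \<open>Idempotency makes the range of \<open>star\<close> its set of fixpoints, so
  \<open>star\<close> disappears from the multipliers.\<close>

lemma hedge_gcs_eq: "hedge_gcs L star = gc_mult L ` {c \<in> carrier L. star c = c}"
  unfolding hedge_gcs_def using star_closed star_idem by (auto simp: image_iff) metis

text \<open>The multiplier \<open>star (a \<rightarrow> b)\<close> is admissible because it lies
  below \<open>a \<rightarrow> b\<close>, and adjointness puts every admissible
  \<open>star c\<close> below it; the supremum is thus a maximum.\<close>

lemma gc_resid_fixpoints:
  assumes "a \<in> carrier L" "b \<in> carrier L" "star a = a" "star b = b"
  shows "gc_resid L star (gc_mult L a) (gc_mult L b) = gc_mult L (star (a \<rightarrow> b))"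
proof -
  have "gc_resid L star (gc_mult L a) (gc_mult L b) =
      \<Squnion>\<^bsub>gc_order L\<^esub> {gc_mult L (star c) | c. c \<in> carrier L \<and> a \<otimes> star c \<sqsubseteq> b}"
    using gc_resid_gc_mult[of a b] assms by simp
  also have "\<dots> = gc_mult L (star (a \<rightarrow> b))"
  proof (rule gc_order_sup_eq_max)
    have "a \<otimes> star (a \<rightarrow> b) \<sqsubseteq> b"
      using assms by (simp add: adjointness star_le star_closed resid_closed)
    then show "gc_mult L (star (a \<rightarrow> b))
        \<in> {gc_mult L (star c) | c. c \<in> carrier L \<and> a \<otimes> star c \<sqsubseteq> b}"
      using assms resid_closed by blast
    show "gc_le L p (gc_mult L (star (a \<rightarrow> b)))"
      if "p \<in> {gc_mult L (star c) | c. c \<in> carrier L \<and> a \<otimes> star c \<sqsubseteq> b}" for p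
      using that assms
      by (auto simp: gc_le_gc_mult_iff star_closed resid_closed star_greatest_fixpoint star_idem
          adjointness)
  qed (auto simp: partial_order_axioms gc_mult_isotone_galois star_closed)
  finally show ?thesis .
qed

end

section \<open>Transfer of the structure from the fixpoints to \<open>S\<close>\<close>

theorem theorem47:
  fixes L :: "('a, 'm) reslat_scheme" and star :: "'a \<Rightarrow> 'a"
  assumes "complete_residuated_lattice L"
    and "idempotent_hedge L star"
  shows "complete_residuated_lattice
    \<lparr>carrier = hedge_gcs L star, eq = (=), le = gc_le L,
     tensor = gc_comp L, resid = gc_resid L star,
     zero = gc_bot L, one = gc_id L\<rparr>"
    (is "complete_residuated_lattice ?S")
proof -
  interpret idempotent_hedge L star by fact
  \<comment> \<open>Each law for pairs is reduced to the same law for multipliers in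
    \<open>K\<close>, by means of \<open>le\<close>, \<open>comp\<close> and
    \<open>res\<close>.\<close>
  define K where "K = {c \<in> carrier L. star c = c}"
  have K: "c \<in> K \<longleftrightarrow> c \<in> carrier L \<and> star c = c" for c
    by (simp add: K_def)
  have S: "hedge_gcs L star = gc_mult L ` K"
    by (simp add: hedge_gcs_eq K_def)
  have le: "gc_le L (gc_mult L c) (gc_mult L d) \<longleftrightarrow> c \<sqsubseteq>\<^bsub>L\<^esub> d" if "c \<in> K" "d \<in> K" for c d
    using that by (simp add: K gc_le_gc_mult_iff)
  have comp: "gc_comp L (gc_mult L c) (gc_mult L d) = gc_mult L (c \<otimes>\<^bsub>L\<^esub> d)"
    if "c \<in> K" "d \<in> K" for c d
    using that by (simp add: K gc_comp_gc_mult)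
  have res: "gc_resid L star (gc_mult L c) (gc_mult L d) = gc_mult L (star (c \<rightarrow>\<^bsub>L\<^esub> d))"
    if "c \<in> K" "d \<in> K" for c d
    using that by (simp add: K gc_resid_fixpoints)
  have K_tensor: "c \<otimes>\<^bsub>L\<^esub> d \<in> K" if "c \<in> K" "d \<in> K" for c d
    using that by (simp add: K tensor_closed star_tensor)
  have K_resid: "star (c \<rightarrow>\<^bsub>L\<^esub> d) \<in> K" if "c \<in> K" "d \<in> K" for c d
    using that by (simp add: K resid_closed star_closed star_idem)
  have K_zero: "\<zero>\<^bsub>L\<^esub> \<in> K" and K_one: "\<one>\<^bsub>L\<^esub> \<in> K"
    by (simp_all add: K zero_closed one_closed star_zero star_one)
  have po: "partial_order ?S"
  proof (unfold_locales, goal_cases)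
    \<comment> \<open>Goals 4 to 6 are reflexivity, antisymmetry and transitivity; the goals about
      equality are left to the closing \<open>auto\<close>.\<close>
    case (4 x) then show ?case
      by (auto simp: S le K)
  next
    case (5 x y) then show ?case
      by (auto simp: S le) (metis K le_antisym)
  next
    case (6 x y z) then show ?case
      by (auto simp: S le) (metis K le_trans)
  qed auto
  interpret S: partial_order ?S by (fact po)
  have cl: "complete_lattice ?S"
  proof (unfold_locales, goal_cases)
    case (1 A)
    then obtain B where B: "B \<subseteq> K" "A = gc_mult L ` B"
      by (auto simp: S subset_image_iff)
    have BL: "B \<subseteq> carrier L"
      using B K by auto
    \<comment> \<open>Suprema of fixpoints are fixpoints, so the supremum formed in \<open>L\<close>
      serves unchanged.\<close>
    have s: "\<Squnion>\<^bsub>L\<^esub>B \<in> K"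
      using BL B by (auto simp: K intro!: star_sup)
    have U: "p \<in> Upper ?S A \<longleftrightarrow> p \<in> gc_mult L ` K \<and> (\<forall>b \<in> B. gc_le L (gc_mult L b) p)" for p
      using mem_Upper_image_iff[of "gc_mult L" B ?S p] 1 B(2) by (simp add: S)
    have "least ?S (gc_mult L (\<Squnion>\<^bsub>L\<^esub>B)) (Upper ?S A)"
      unfolding least_def
    proof (intro conjI ballI Upper_closed)
      show "gc_mult L (\<Squnion>\<^bsub>L\<^esub>B) \<in> Upper ?S A"
        using s B(1) BL by (auto simp: U le subsetD intro: sup_upper)
      fix p assume "p \<in> Upper ?S A"
      then obtain u where "u \<in> K" "p = gc_mult L u" "\<forall>b \<in> B. b \<sqsubseteq>\<^bsub>L\<^esub> u"
        using B(1) le by (auto simp: U subsetD)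
      then show "gc_mult L (\<Squnion>\<^bsub>L\<^esub>B) \<sqsubseteq>\<^bsub>?S\<^esub> p"
        using s BL by (auto simp: le K intro: sup_least)
    qed
    then show ?case by blast
  next
    case (2 A)
    then obtain B where B: "B \<subseteq> K" "A = gc_mult L ` B"
      by (auto simp: S subset_image_iff)
    have BL: "B \<subseteq> carrier L"
      using B K by auto
    \<comment> \<open>An infimum of fixpoints need not be a fixpoint; the candidate is the greatest
      fixpoint below it.\<close>
    have i: "star (\<Sqinter>\<^bsub>L\<^esub>B) \<in> K"
      using BL by (simp add: K star_closed star_idem)
    have U: "p \<in> Lower ?S A \<longleftrightarrow> p \<in> gc_mult L ` K \<and> (\<forall>b \<in> B. gc_le L p (gc_mult L b))" for p
      using mem_Lower_image_iff[of "gc_mult L" B ?S p] 2 B(2) by (simp add: S)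
    have "greatest ?S (gc_mult L (star (\<Sqinter>\<^bsub>L\<^esub>B))) (Lower ?S A)"
      unfolding greatest_def
    proof (intro conjI ballI Lower_closed)
      have "star (\<Sqinter>\<^bsub>L\<^esub>B) \<sqsubseteq>\<^bsub>L\<^esub> b" if "b \<in> B" for b
        using le_trans[OF star_le inf_lower[OF BL that]] that BL by (auto simp: star_closed)
      then show "gc_mult L (star (\<Sqinter>\<^bsub>L\<^esub>B)) \<in> Lower ?S A"
        using i B(1) by (auto simp: U le subsetD)
      fix p assume "p \<in> Lower ?S A"
      then obtain l where "l \<in> K" "p = gc_mult L l" "\<forall>b \<in> B. l \<sqsubseteq>\<^bsub>L\<^esub> b"
        using B(1) le by (auto simp: U subsetD)
      \<comment> \<open>Since \<open>l\<close> is itself a fixpoint, lying below the infimum already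
        puts it below \<open>star\<close> of the infimum.\<close>
      then show "p \<sqsubseteq>\<^bsub>?S\<^esub> gc_mult L (star (\<Sqinter>\<^bsub>L\<^esub>B))"
        using i BL by (auto simp: le K star_greatest_fixpoint intro: inf_greatest)
    qed
    then show ?case by blast
  qed
  show ?thesis
    unfolding complete_residuated_lattice_def
  proof (intro conjI cl, unfold_locales, goal_cases)
    \<comment> \<open>The bottom pair is rewritten as multiplication by \<open>\<zero>\<close>,
      which exhibits it as an image of an element of \<open>K\<close>; \<open>gc_id L\<close> is
      treated alike.\<close>
    case 1 show ?case
      using K_zero by (auto simp: least_def S le zero_le K simp flip: gc_mult_zero)
  next
    case 2 show ?case
      using K_one by (auto simp: greatest_def S le le_one K simp flip: gc_mult_one)
  next
    case (3 x y) then show ?case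
      by (auto simp: S comp K_tensor)
  next
    case (4 x y z) then show ?case
      by (auto simp: S comp K_tensor) (simp add: K tensor_assoc)
  next
    case (5 x y) then show ?case
      by (auto simp: S comp) (simp add: K tensor_comm)
  next
    case (6 x) then show ?case
      using K_one by (auto simp: S comp simp flip: gc_mult_one) (simp add: K one_tensor)
  next
    case (7 x y) then show ?case
      by (auto simp: S res K_resid)
  next
    \<comment> \<open>Adjointness in \<open>L\<close> gives a comparison with
      \<open>c \<rightarrow> e\<close>, where \<open>c\<close> and \<open>e\<close> are the
      multipliers of \<open>x\<close> and \<open>z\<close>; the multiplier of \<open>y\<close> is a
      fixpoint, so \<open>star\<close> may be applied on the right.\<close>
    case (8 x y z) then show ?case
      by (auto simp: S comp res le K_tensor K_resid)
        (simp_all add: K adjointness star_greatest_fixpoint resid_closed)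
  qed
qed

end
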